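(* Let $\lambda_0\ge 1$ be an integer, $\rho>1$ a real number, and $\lambda_k=\lceil\lambda_{k-1}\rho\rceil$ for $k\ge 1$. Let $\mathcal{L}^*(\hat\lambda,\rho)$ be the loss function of this restart strategy, and let $$\mathcal{L}^*_{\mathrm{up}}(\hat\lambda,\rho)=\lambda_0\rho+\frac{\ln(\hat\lambda/\lambda_0)}{\ln(\rho)}+\left(\hat\lambda-\lambda_0\right)\left(\rho+\frac{1}{\rho-1}\right).$$ Then $\mathcal{L}^*_{\mathrm{up}}(\hat\lambda,\rho)$ is an upper bound of $\mathcal{L}^*(\hat\lambda,\rho)$, i.e. $\mathcal{L}^*(\hat\lambda,\rho)\le\mathcal{L}^*_{\mathrm{up}}(\hat\lambda,\rho)$ for all integers $\hat\lambda\ge\lambda_0$.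
   Context: For a restart strategy $(\lambda_0,\lambda_1,\lambda_2,\ldots)$ (an unbounded sequence of natural numbers) and an integer $\hat\lambda\ge\lambda_0$, let $\hat k(\hat\lambda)=\min\{k\ge 0:\lambda_k\ge\hat\lambda\}$. The loss function is $\mathcal{L}(\hat\lambda)=\sum_{k=0}^{\hat k(\hat\lambda)}\lambda_k-\hat\lambda$; it is denoted $\mathcal{L}^*(\hat\lambda,\rho)$ for the strategy $\lambda_k=\lceil\lambda_{k-1}\rho\rceil$. *)

theory Defs
  imports Complex_Main
begin

definition restart_strategy :: "(nat \<Rightarrow> nat) \<Rightarrow> bool" where
  "restart_strategy lam \<longleftrightarrow> (\<forall>n. \<exists>k. n \<le> lam k)"

text \<open>The minimum exists whenever \<^term>\<open>lam\<close> is a restart strategy.\<close>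

definition khat :: "(nat \<Rightarrow> nat) \<Rightarrow> nat \<Rightarrow> nat" where
  "khat lam L = (LEAST k. lam k \<ge> L)"

definition loss :: "(nat \<Rightarrow> nat) \<Rightarrow> nat \<Rightarrow> int" where
  "loss lam L = (\<Sum>k = 0..khat lam L. int (lam k)) - int L"

text \<open>The conversion \<^const>\<open>nat\<close> is exact here for \<open>\<rho> \<ge> 0\<close>.\<close>

primrec geo_strategy :: "nat \<Rightarrow> real \<Rightarrow> nat \<Rightarrow> nat" where
  "geo_strategy l0 \<rho> 0 = l0"
| "geo_strategy l0 \<rho> (Suc k) = nat \<lceil>real (geo_strategy l0 \<rho> k) * \<rho>\<rceil>"

definition loss_geo :: "nat \<Rightarrow> nat \<Rightarrow> real \<Rightarrow> int" where
  "loss_geo l0 L \<rho> = loss (geo_strategy l0 \<rho>) L"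

definition loss_geo_up :: "nat \<Rightarrow> nat \<Rightarrow> real \<Rightarrow> real" where
  "loss_geo_up l0 L \<rho> =
     real l0 * \<rho> + ln (real L / real l0) / ln \<rho>
       + (real L - real l0) * (\<rho> + 1 / (\<rho> - 1))"

lemma restart_strategy_geo_strategy:
  assumes "l0 \<ge> 1" and "\<rho> > 1"
  shows "restart_strategy (geo_strategy l0 \<rho>)"
proof -
  have "Suc k \<le> geo_strategy l0 \<rho> k" for k
  proof (induction k)
    case 0
    then show ?case using assms by simp
  next
    case (Suc k)
    let ?a = "geo_strategy l0 \<rho> k"
    have "real ?a * 1 < real ?a * \<rho>"
      using Suc assms by (intro mult_strict_left_mono) auto
    then have "int ?a < \<lceil>real ?a * \<rho>\<rceil>"
      by (simp add: less_ceiling_iff)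
    then have "?a < geo_strategy l0 \<rho> (Suc k)"
      by simp
    then show ?case using Suc by linarith
  qed
  then show ?thesis
    unfolding restart_strategy_def by (meson Suc_leD)
qed

end

theory Submission
  imports Defs
begin

text \<open>Each step multiplies by at least \<open>\<rho>\<close>, so \<open>(\<rho> - 1) \<lambda>\<^sub>k \<le> \<lambda>\<^sub>k\<^sub>+\<^sub>1 - \<lambda>\<^sub>k\<close> and the partial sums
  telescope. If \<open>m = \<lambda>\<^sub>n\<close> is the last cutoff below \<open>L\<close>, the cutoffs before \<open>m\<close> contribute at most
  \<open>(m - \<lambda>\<^sub>0) / (\<rho> - 1)\<close>, and the last two terms exceed \<open>L\<close> by at most \<open>m + (m \<rho> + 1) - L \<le> m \<rho>\<close>,
  as \<open>m + 1 \<le> L\<close>. Since \<open>m \<le> L\<close>, the sum of the two is at most the claimed bound even without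
  its nonnegative logarithmic term.\<close>

lemma geo_strategy_Suc_ge: "real (geo_strategy l0 \<rho> k) * \<rho> \<le> real (geo_strategy l0 \<rho> (Suc k))"
  by (simp add: of_nat_ceiling)

text \<open>For \<open>\<rho> \<ge> 0\<close> the ceiling is nonnegative, so \<open>nat\<close> does
  not truncate it and rounding up adds at most 1.\<close>

lemma geo_strategy_Suc_le:
  assumes "\<rho> \<ge> 0"
  shows "real (geo_strategy l0 \<rho> (Suc k)) \<le> real (geo_strategy l0 \<rho> k) * \<rho> + 1"
proof -
  have "0 \<le> real (geo_strategy l0 \<rho> k) * \<rho>"
    using assms by simp
  then show ?thesis
    by (simp add: of_int_ceiling_le_add_one)
qed

lemma sum_geo_strategy_le:
  "(\<rho> - 1) * (\<Sum>k<n. real (geo_strategy l0 \<rho> k)) \<le> real (geo_strategy l0 \<rho> n) - real l0"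
proof (induction n)
  case 0
  then show ?case by simp
next
  case (Suc n)
  then show ?case
    using geo_strategy_Suc_ge[of l0 \<rho> n] by (simp add: algebra_simps del: geo_strategy.simps)
qed

lemma less_khat: "k < khat lam L \<Longrightarrow> lam k < L"
  unfolding khat_def using not_less_Least by (metis not_le)

theorem corollary1:
  fixes l0 :: nat and \<rho> :: real
  assumes "l0 \<ge> 1" and "\<rho> > 1"
  shows "\<forall>L::nat. L \<ge> l0 \<longrightarrow> real_of_int (loss_geo l0 L \<rho>) \<le> loss_geo_up l0 L \<rho>"
proof (intro allI impI)
  fix L :: nat
  assume L: "L \<ge> l0"
  let ?g = "geo_strategy l0 \<rho>"
  have log: "0 \<le> ln (real L / real l0) / ln \<rho>"
    using assms L by simp
  have loss: "real_of_int (loss_geo l0 L \<rho>) = (\<Sum>k\<le>khat ?g L. real (?g k)) - real L"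
    by (simp add: loss_geo_def loss_def atLeast0AtMost)
  show "real_of_int (loss_geo l0 L \<rho>) \<le> loss_geo_up l0 L \<rho>"
  proof (cases "khat ?g L")
    case 0
    \<comment> \<open>The sum is the single term \<open>l0\<close>, so the loss
      \<open>l0 - L\<close> is at most 0, while every summand of the bound is nonnegative.\<close>
    have "0 \<le> real l0 * \<rho>" "0 \<le> (real L - real l0) * (\<rho> + 1 / (\<rho> - 1))"
      using assms L by simp_all
    then show ?thesis
      using log loss 0 L by (simp add: loss_geo_up_def)
  next
    case (Suc n)
    define m where "m = real (?g n)"
    \<comment> \<open>Strictness between integers gains the 1 that later absorbs the rounding error
      of the final ceiling.\<close>
    have m: "m + 1 \<le> real L"
      using less_khat[of n ?g L] Suc by (simp add: m_def)
    have sum: "(\<Sum>k<n. real (?g k)) \<le> (m - real l0) / (\<rho> - 1)"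
      using sum_geo_strategy_le[of \<rho> l0 n] assms by (simp add: m_def field_simps)
    have "(\<Sum>k\<le>khat ?g L. real (?g k)) = (\<Sum>k<n. real (?g k)) + m + real (?g (Suc n))"
      by (simp add: Suc lessThan_Suc_atMost[symmetric] m_def)
    also have "\<dots> \<le> (m - real l0) / (\<rho> - 1) + m + (m * \<rho> + 1)"
      using sum geo_strategy_Suc_le[of \<rho> l0 n] assms unfolding m_def by linarith
    finally have "real_of_int (loss_geo l0 L \<rho>) \<le> (m - real l0) / (\<rho> - 1) + m * \<rho>"
      using loss m by linarith
    \<comment> \<open>Splitting off \<open>l0 * \<rho>\<close> leaves an expression increasing in
      \<open>m\<close>, so \<open>m\<close> can be replaced by \<open>L\<close>.\<close>
    also have "\<dots> = real l0 * \<rho> + (m - real l0) * (\<rho> + 1 / (\<rho> - 1))"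
      by (simp add: algebra_simps)
    also have "\<dots> \<le> real l0 * \<rho> + (real L - real l0) * (\<rho> + 1 / (\<rho> - 1))"
      using m assms by (intro add_left_mono mult_right_mono) auto
    finally show ?thesis
      using log by (simp add: loss_geo_up_def)
  qed
qed

end
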